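(* (Efficiency of DAG-SHAP.) Let $\mathcal{G}$ be a causal DAG on features $X_1,\dots,X_n$ and target $Y$ with edges $e_1,\dots,e_m$, let $f:\mathbb{R}^n\to\mathbb{R}$ be the model and $x\in\mathbb{R}^n$ the explained input, and let $\Psi(e_i)$ and $\Phi(k)$ be the DAG-SHAP attribution values of edges and features. Then the attributions of all features sum to the difference between the model output at $x$ and the baseline: $$\sum_{k=1}^n \Phi(k)=f(x)-\mathbb{E}[f(\mathbf{x})],$$ where $\mathbf{x}$ is a random feature vector drawn from the data distribution $P$.
   Context: Causal graph. $\mathcal{G}$ is a finite directed acyclic graph with vertices the features $X_1,\dots,X_n$ together with a target vertex $Y$ (the model output), which has no outgoing edges. The directed edges are $e_1,\dots,e_m$; edge $e_i$ goes from its parent $p_i$ (a feature) to its child $c_i$ (a feature or $Y$). An edge $X_j\to Y$ represents the direct dependence of $f$ on its $j$-th argument; every feature on which $f$ depends has an edge to $Y$. The random feature vector $\mathbf{x}=(\mathbf{x}_1,\dots,\mathbf{x}_n)$ has distribution $P$ that is Markov with respect to the DAG: $P(\mathbf{x})=\prod_{i=1}^n P(\mathbf{x}_i\mid \mathbf{x}_{pa(i)})$, where $pa(i)$ is the set of parents of feature $i$ and the factors are fixed conditional distributions (Markov kernels). All expectations below are assumed to exist. Edge intervention. Fix the explained input $x=(x_1,\dots,x_n)\in\mathbb{R}^n$. For $\mathcal{S}\subseteq\{1,\dots,m\}$, the edge intervention $\operatorname{do}(\mathbf{e}_{\mathcal{S}}=e_{\mathcal{S}})$ forces the value transmitted along each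 edge $e_i$, $i\in\mathcal{S}$, to be $x_{p_i}$, leaving all other edges unchanged. That is, the features are generated in topological order: $\tilde{\mathbf{x}}_i$ is drawn from the kernel $P(\mathbf{x}_i\mid \mathbf{x}_{pa(i)}=\cdot)$, where the value supplied for a parent $j\in pa(i)$ is $x_j$ if the edge $X_j\to X_i$ is in $\mathcal{S}$ and $\tilde{\mathbf{x}}_j$ otherwise. The model is then evaluated at the vector whose $j$-th coordinate is $x_j$ if the edge $X_j\to Y$ is in $\mathcal{S}$, and $\tilde{\mathbf{x}}_j$ otherwise. The expectation of the resulting model output is denoted $U(\mathcal{S})=\mathbb{E}[f(\mathbf{x})\mid \operatorname{do}(\mathbf{e}_{\mathcal{S}}=e_{\mathcal{S}})]$. In particular $U(\emptyset)=\mathbb{E}[f(\mathbf{x})]$. DAG-SHAP. Let $\Pi$ be the set of topological orderings of the edges, i.e. bijections $\pi:\{1,\dots,m\}\to\{1,\dots,m\}$ ($\pi(i)$ is the position of $e_i$) such that $\pi(j)<\pi(k)$ whenever the child of $e_j$ is the parent of $e_k$. For $\pi\in\Pi$ put $\mathcal{S}_\pi^i=\{j:\pi(j)<\pi(i)\}$ and $\underline{\mathcal{S}}_\pi^i=\{j:\pi(j)\le\pi(i)\}$. The attribution of edge $e_i$ is $$\Psi(e_i)=\frac{1}{|\Pi|}\sum_{\pi\in\Pi}\left(U(\underline{\mathcal{S}}_\pi^i)-U(\mathcal{S}_\pi^i)\right),$$ and the attribution of feature $k$ is $\Phi(k)=\sum_{e\in\mathcal{O}_k}\Psi(e)$, where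 $\mathcal{O}_k$ is the set of edges with parent $X_k$. *)

theory Defs
  imports "HOL-Probability.Probability"
begin

datatype 'n vertex = Feature 'n | Target

text \<open>The edges are numbered from 1 to \<open>num_edges\<close>. A parent is always a feature,
  so \<open>Target\<close> has no outgoing edges by typing.\<close>

record 'n causal_graph =
  num_edges :: nat
  parent :: "nat \<Rightarrow> 'n"
  child :: "nat \<Rightarrow> 'n vertex"

definition edges :: "'n causal_graph \<Rightarrow> nat set" where
  "edges G = {1..num_edges G}"

definition causal_dag :: "'n causal_graph \<Rightarrow> bool" where
  "causal_dag G \<longleftrightarrow>
     inj_on (\<lambda>i. (parent G i, child G i)) (edges G) \<and>
     acyclic ((\<lambda>i. (Feature (parent G i), child G i)) ` edges G)"

definition pa :: "'n causal_graph \<Rightarrow> 'n \<Rightarrow> 'n set" where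
  "pa G i = {parent G k | k. k \<in> edges G \<and> child G k = Feature i}"

definition depends_on :: "(real^'n \<Rightarrow> real) \<Rightarrow> 'n \<Rightarrow> bool" where
  "depends_on f j \<longleftrightarrow> (\<exists>u v. (\<forall>i. i \<noteq> j \<longrightarrow> u $ i = v $ i) \<and> f u \<noteq> f v)"

definition model_edges :: "'n causal_graph \<Rightarrow> (real^'n \<Rightarrow> real) \<Rightarrow> bool" where
  "model_edges G f \<longleftrightarrow>
     (\<forall>j. depends_on f j \<longrightarrow> (\<exists>k\<in>edges G. parent G k = j \<and> child G k = Target))"

definition markov_kernels ::
    "'n causal_graph \<Rightarrow> ('n \<Rightarrow> ('n \<Rightarrow> real) \<Rightarrow> real measure) \<Rightarrow> bool" where
  "markov_kernels G \<kappa> \<longleftrightarrow>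
     (\<forall>i. \<kappa> i \<in> (\<Pi>\<^sub>M j\<in>pa G i. borel) \<rightarrow>\<^sub>M prob_algebra borel)"

definition set_coord :: "real^'n \<Rightarrow> 'n \<Rightarrow> real \<Rightarrow> real^'n" where
  "set_coord \<omega> i t = (\<chi> j. if j = i then t else \<omega> $ j)"

text \<open>\<open>kernel_product G K V M\<close>: \<open>M\<close> is the law obtained by drawing the coordinates in \<open>V\<close>
  one after the other in a topological order, coordinate \<open>i\<close> from \<open>K i \<omega>\<close> with \<open>\<omega>\<close> the vector
  drawn so far. For \<open>V = UNIV\<close> this is the product of the kernels \<open>K i\<close>, read as an iterated
  integral. Coordinates not yet drawn hold the dummy value 0; it is never seen by a kernel that
  reads only the parents of \<open>i\<close>.\<close>

inductive kernel_product ::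
    "'n::finite causal_graph \<Rightarrow> ('n \<Rightarrow> real^'n \<Rightarrow> real measure) \<Rightarrow> 'n set \<Rightarrow> (real^'n) measure \<Rightarrow> bool"
  for G K where
  empty: "kernel_product G K {} (return borel 0)"
| draw: "kernel_product G K V M \<Longrightarrow> i \<notin> V \<Longrightarrow> pa G i \<subseteq> V \<Longrightarrow>
     kernel_product G K (insert i V) (M \<bind> (\<lambda>\<omega>. distr (K i \<omega>) borel (set_coord \<omega> i)))"

definition markov_distribution ::
    "'n::finite causal_graph \<Rightarrow> ('n \<Rightarrow> ('n \<Rightarrow> real) \<Rightarrow> real measure) \<Rightarrow> (real^'n) measure \<Rightarrow> bool" where
  "markov_distribution G \<kappa> P \<longleftrightarrow>
     kernel_product G (\<lambda>i \<omega>. \<kappa> i (\<lambda>j\<in>pa G i. \<omega> $ j)) UNIV P"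

text \<open>The feature vector \<open>\<omega>\<close> as it arrives at vertex \<open>v\<close> when the edges in \<open>S\<close> transmit
  the values of \<open>x\<close>.\<close>

definition received ::
    "'n causal_graph \<Rightarrow> nat set \<Rightarrow> real^'n \<Rightarrow> 'n vertex \<Rightarrow> real^'n \<Rightarrow> real^'n" where
  "received G S x v \<omega> =
     (\<chi> j. if \<exists>k\<in>S. parent G k = j \<and> child G k = v then x $ j else \<omega> $ j)"

text \<open>For Markov kernels on a DAG the law exists (by acyclicity) and does not depend on the
  topological order (by Fubini), so \<open>THE\<close> is well-defined.\<close>

definition do_distribution ::
    "'n::finite causal_graph \<Rightarrow> ('n \<Rightarrow> ('n \<Rightarrow> real) \<Rightarrow> real measure) \<Rightarrow> real^'n \<Rightarrow> nat set
      \<Rightarrow> (real^'n) measure" where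
  "do_distribution G \<kappa> x S =
     (THE M. kernel_product G
        (\<lambda>i \<omega>. \<kappa> i (\<lambda>j\<in>pa G i. received G S x (Feature i) \<omega> $ j)) UNIV M)"

definition U ::
    "'n::finite causal_graph \<Rightarrow> ('n \<Rightarrow> ('n \<Rightarrow> real) \<Rightarrow> real measure) \<Rightarrow> (real^'n \<Rightarrow> real)
      \<Rightarrow> real^'n \<Rightarrow> nat set \<Rightarrow> real" where
  "U G \<kappa> f x S = (\<integral>\<omega>. f (received G S x Target \<omega>) \<partial>do_distribution G \<kappa> x S)"

text \<open>\<open>permutes\<close> (identity outside the edge set) makes the set of orderings finite.\<close>

definition edge_orderings :: "'n causal_graph \<Rightarrow> (nat \<Rightarrow> nat) set" where
  "edge_orderings G =
     {\<pi>. \<pi> permutes edges G \<and>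
         (\<forall>j\<in>edges G. \<forall>k\<in>edges G. child G j = Feature (parent G k) \<longrightarrow> \<pi> j < \<pi> k)}"

definition edge_attribution ::
    "'n::finite causal_graph \<Rightarrow> ('n \<Rightarrow> ('n \<Rightarrow> real) \<Rightarrow> real measure) \<Rightarrow> (real^'n \<Rightarrow> real)
      \<Rightarrow> real^'n \<Rightarrow> nat \<Rightarrow> real" where
  "edge_attribution G \<kappa> f x i =
     1 / real (card (edge_orderings G)) *
     (\<Sum>\<pi>\<in>edge_orderings G.
        U G \<kappa> f x {j \<in> edges G. \<pi> j \<le> \<pi> i} - U G \<kappa> f x {j \<in> edges G. \<pi> j < \<pi> i})"

definition feature_attribution ::
    "'n::finite causal_graph \<Rightarrow> ('n \<Rightarrow> ('n \<Rightarrow> real) \<Rightarrow> real measure) \<Rightarrow> (real^'n \<Rightarrow> real)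
      \<Rightarrow> real^'n \<Rightarrow> 'n \<Rightarrow> real" where
  "feature_attribution G \<kappa> f x k =
     (\<Sum>i | i \<in> edges G \<and> parent G i = k. edge_attribution G \<kappa> f x i)"

end

theory Submission
  imports Defs
begin

text \<open>For every topological ordering of the edges the marginal contributions telescope to
  \<open>U (edges G) - U {}\<close>, so their average does too, once some ordering exists. Forcing no edge
  reproduces the observational law; forcing all edges makes the model see \<open>x\<close> in every
  coordinate it depends on, so its output is the constant \<open>f x\<close>. Both evaluations need the
  interventional law to be the unique law generated by its kernels: any coordinate that is not
  a parent of a drawn one can be moved to the last position by Fubini.\<close>

section \<open>Laws generated by local kernels: commuting draws, uniqueness, existence\<close>

lemma measurable_set_coord:
  "(\<lambda>(\<omega>, t). set_coord \<omega> i t) \<in> borel \<Otimes>\<^sub>M borel \<rightarrow>\<^sub>M (borel :: (real^'n::finite) measure)"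
proof -
  have "continuous_on UNIV (\<lambda>p::(real^'n) \<times> real. if j = i then snd p else fst p $ j)" for j
    by (cases "j = i") (auto intro!: continuous_intros)
  then have "continuous_on UNIV (\<lambda>p::(real^'n) \<times> real. set_coord (fst p) i (snd p))"
    unfolding set_coord_def by (intro continuous_on_vec_lambda)
  then show ?thesis
    by (simp add: borel_prod split_beta' borel_measurable_continuous_onI)
qed

lemma set_coord_commute:
  "i \<noteq> k \<Longrightarrow> set_coord (set_coord \<omega> i s) k t = set_coord (set_coord \<omega> k t) i s"
  by (auto simp: set_coord_def vec_eq_iff)

text \<open>Abstracts the kernels of all edge interventions at once, so that existence and
  uniqueness of the generated law are proved a single time. Assumption \<open>local\<close> is what
  lets draws be exchanged.\<close>

locale local_kernels =
  fixes G :: "'n::finite causal_graph" and K :: "'n \<Rightarrow> real^'n \<Rightarrow> real measure"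
  assumes kernel: "K i \<in> borel \<rightarrow>\<^sub>M prob_algebra borel"
    and local: "(\<And>j. j \<in> pa G i \<Longrightarrow> \<omega> $ j = \<omega>' $ j) \<Longrightarrow> K i \<omega> = K i \<omega>'"
begin

definition step :: "'n \<Rightarrow> real^'n \<Rightarrow> (real^'n) measure" where
  "step i \<omega> = distr (K i \<omega>) borel (set_coord \<omega> i)"

lemma measurable_step: "step i \<in> borel \<rightarrow>\<^sub>M prob_algebra borel"
  unfolding step_def
  by (rule measurable_distr_prob_space2[OF kernel measurable_set_coord])

lemma prob_space_K: "prob_space (K i \<omega>)" and sets_K [measurable_cong, simp]: "sets (K i \<omega>) = sets borel"
  using measurable_space[OF kernel, of \<omega>] by (auto simp: space_prob_algebra)

lemma space_K [simp]: "space (K i \<omega>) = UNIV"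
  using sets_eq_imp_space_eq[OF sets_K] by simp

lemma measurable_set_coord_snd: "set_coord \<omega> i \<in> borel \<rightarrow>\<^sub>M borel"
  using measurable_Pair2[OF measurable_set_coord, of \<omega>] by simp

lemma measurable_set_coord_K: "set_coord \<omega> i \<in> K k \<omega>' \<rightarrow>\<^sub>M borel"
  using measurable_set_coord_snd by (simp cong: measurable_cong_sets)

lemma K_set_coord: "i \<notin> pa G k \<Longrightarrow> K k (set_coord \<omega> i t) = K k \<omega>"
  by (rule local) (auto simp: set_coord_def)

lemma kernel_product_prob_algebra:
  "kernel_product G K V M \<Longrightarrow> M \<in> space (prob_algebra borel)"
proof (induction rule: kernel_product.induct)
  case empty
  then show ?case
    by (simp add: space_prob_algebra prob_space_return)
next
  case (draw V M i)
  then show ?case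
    using prob_space_bind'[OF draw.IH measurable_step[of i]] sets_bind'[OF draw.IH measurable_step[of i]]
    by (simp add: space_prob_algebra step_def[abs_def])
qed

text \<open>As \<open>K k\<close> does not read coordinate \<open>i\<close>, the second draw may use
  the old \<open>\<omega>\<close>. Two independent draws remain, the form in which Fubini
  applies.\<close>

lemma step_bind_step:
  assumes "i \<notin> pa G k"
  shows "step i \<omega> \<bind> step k =
    K i \<omega> \<bind> (\<lambda>s. K k \<omega> \<bind> (\<lambda>t. return borel (set_coord (set_coord \<omega> i s) k t)))"
proof -
  have "step i \<omega> \<bind> step k = K i \<omega> \<bind> (\<lambda>s. step k (set_coord \<omega> i s))"
    unfolding step_def[of i]
    by (intro bind_distr[OF measurable_set_coord_K measurable_prob_algebraD[OF measurable_step]]) simp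
  also have "\<dots> = K i \<omega> \<bind> (\<lambda>s. K k \<omega> \<bind> (\<lambda>t. return borel (set_coord (set_coord \<omega> i s) k t)))"
    using assms
    by (intro bind_cong refl)
      (simp add: step_def K_set_coord bind_return_distr'[OF _ measurable_set_coord_K])
  finally show ?thesis .
qed

lemma step_commute:
  assumes "i \<notin> pa G k" "k \<notin> pa G i" "i \<noteq> k"
  shows "step i \<omega> \<bind> step k = step k \<omega> \<bind> step i"
proof -
  interpret pair_prob_space "K i \<omega>" "K k \<omega>"
    by (simp add: pair_prob_space_def pair_sigma_finite_def prob_space_K
        prob_space_imp_sigma_finite)
  have "(\<lambda>p. set_coord (set_coord \<omega> i (fst p)) k (snd p)) \<in> borel \<Otimes>\<^sub>M borel \<rightarrow>\<^sub>M borel"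
    using measurable_compose[OF measurable_Pair[OF
        measurable_compose[OF measurable_fst measurable_set_coord_snd] measurable_snd]
        measurable_set_coord]
    by simp
  then have "(\<lambda>(s, t). return borel (set_coord (set_coord \<omega> i s) k t))
      \<in> K i \<omega> \<Otimes>\<^sub>M K k \<omega> \<rightarrow>\<^sub>M subprob_algebra borel"
    unfolding split_beta'
    by (intro measurable_compose[OF _ return_measurable])
      (simp add: measurable_cong_sets[OF sets_pair_measure_cong[OF sets_K sets_K] refl])
  \<comment> \<open>Fubini swaps the two draws; the writes commute because they hit different
    coordinates.\<close>
  from bind_rotate[OF this] show ?thesis
    using assms by (simp add: step_bind_step set_coord_commute[OF \<open>i \<noteq> k\<close>])
qed

lemma kernel_product_draw:
  "kernel_product G K V M \<Longrightarrow> i \<notin> V \<Longrightarrow> pa G i \<subseteq> V \<Longrightarrow> kernel_product G K (insert i V) (M \<bind> step i)"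
  unfolding step_def by (rule kernel_product.draw)

lemma bind_step_commute:
  assumes "M \<in> space (prob_algebra borel)" "i \<notin> pa G k" "k \<notin> pa G i" "i \<noteq> k"
  shows "M \<bind> step i \<bind> step k = M \<bind> step k \<bind> step i"
proof -
  have m: "step j \<in> M \<rightarrow>\<^sub>M subprob_algebra borel" for j
    using measurable_prob_algebraD[OF measurable_step] assms(1)
    by (auto simp: space_prob_algebra cong: measurable_cong_sets)
  show ?thesis
    by (simp add: bind_assoc[OF m measurable_prob_algebraD[OF measurable_step]]
        step_commute[OF assms(2-)])
qed

lemma kernel_product_parents:
  "kernel_product G K V M \<Longrightarrow> i \<in> V \<Longrightarrow> pa G i \<subseteq> V"
  by (induction rule: kernel_product.induct) auto

text \<open>Exchange argument: if some \<open>k\<close> other than \<open>i\<close> was drawn last,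
  the induction hypothesis moves \<open>i\<close> to the end of the earlier draws, and one more swap
  moves it past \<open>k\<close>.\<close>

lemma kernel_product_last:
  assumes "kernel_product G K V M" "i \<in> V" "\<And>j. j \<in> V \<Longrightarrow> i \<notin> pa G j"
  shows "\<exists>M'. kernel_product G K (V - {i}) M' \<and> M = M' \<bind> step i"
  using assms
proof (induction rule: kernel_product.induct)
  case empty
  then show ?case by simp
next
  case (draw V M k)
  show ?case
  proof (cases "k = i")
    case True
    with draw show ?thesis
      by (auto simp: step_def[abs_def])
  next
    case False
    with draw obtain M' where M': "kernel_product G K (V - {i}) M'" "M = M' \<bind> step i"
      by auto
    \<comment> \<open>The first holds because \<open>i\<close> has no child among the drawn
      coordinates; the second because the parents of \<open>i\<close> lie in \<open>V\<close>, which
      lacks \<open>k\<close>.\<close>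
    have k: "i \<notin> pa G k" "k \<notin> pa G i"
      using draw False kernel_product_parents[OF draw.hyps(1), of i] by auto
    have "kernel_product G K (insert k (V - {i})) (M' \<bind> step k)"
      using M' draw.hyps k by (intro kernel_product_draw) auto
    moreover have "insert k V - {i} = insert k (V - {i})"
      using False by auto
    moreover have "M \<bind> step k = M' \<bind> step k \<bind> step i"
      using bind_step_commute[OF kernel_product_prob_algebra[OF M'(1)] k] False M'(2) by simp
    ultimately show ?thesis
      by (auto simp: step_def[abs_def])
  qed
qed

lemma kernel_product_unique:
  assumes "kernel_product G K V M" "kernel_product G K V M'"
  shows "M = M'"
  using assms
proof (induction arbitrary: M' rule: kernel_product.induct)
  case empty
  then show ?case by (auto elim: kernel_product.cases)
next
  case (draw V M i)
  \<comment> \<open>The parents of every coordinate in \<open>insert i V\<close> lie in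
    \<open>V\<close>, so \<open>i\<close> can be made the last draw of the other derivation as
    well.\<close>
  have "i \<notin> pa G j" if "j \<in> insert i V" for j
    using that draw.hyps kernel_product_parents[OF draw.hyps(1), of j] by auto
  from kernel_product_last[OF draw.prems _ this] obtain M'' where
    "kernel_product G K (insert i V - {i}) M''" "M' = M'' \<bind> step i"
    by auto
  with draw.hyps draw.IH[of M''] show ?case
    by (simp add: step_def[abs_def])
qed

lemma kernel_product_extend:
  assumes wf: "wf {(j, i). j \<in> pa G i}" and "kernel_product G K V M"
  shows "\<exists>N. kernel_product G K UNIV N"
  using assms(2)
proof (induction "card (- V)" arbitrary: V M rule: less_induct)
  case less
  show ?case
  proof (cases "V = UNIV")
    case True
    with less.prems show ?thesis by auto
  next
    case False
    \<comment> \<open>A minimal undrawn coordinate has all its parents drawn already, so it can come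
      next.\<close>
    then obtain i where i: "i \<in> - V" "\<And>j. (j, i) \<in> {(j, i). j \<in> pa G i} \<Longrightarrow> j \<notin> - V"
      using wfE_min[OF wf, of _ "- V"] by (metis ComplI UNIV_eq_I)
    then have "kernel_product G K (insert i V) (M \<bind> step i)"
      by (intro kernel_product_draw less.prems) auto
    moreover have "card (- insert i V) < card (- V)"
      using i by (intro psubset_card_mono) auto
    ultimately show ?thesis
      using less.hyps by blast
  qed
qed

lemma ex1_kernel_product:
  assumes "wf {(j, i). j \<in> pa G i}"
  shows "\<exists>!M. kernel_product G K UNIV M"
  using kernel_product_extend[OF assms kernel_product.empty] kernel_product_unique by blast

end

section \<open>Edge interventions as local kernels\<close>

lemma local_kernels_received:
  fixes G :: "'n::finite causal_graph"
  assumes "markov_kernels G \<kappa>"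
  shows "local_kernels G (\<lambda>i \<omega>. \<kappa> i (\<lambda>j\<in>pa G i. received G S x (Feature i) \<omega> $ j))"
proof
  fix i
  \<comment> \<open>Each received coordinate is either the constant \<open>x $ j\<close> or a
    projection.\<close>
  have "(\<lambda>\<omega>. received G S x (Feature i) \<omega> $ j) \<in> borel_measurable borel" for j
    by (cases "\<exists>k\<in>S. parent G k = j \<and> child G k = Feature i")
      (simp_all add: received_def borel_measurable_continuous_onI continuous_on_component)
  then have "(\<lambda>\<omega>. \<lambda>j\<in>pa G i. received G S x (Feature i) \<omega> $ j) \<in> borel \<rightarrow>\<^sub>M (\<Pi>\<^sub>M j\<in>pa G i. borel)"
    by (intro measurable_restrict)
  then show "(\<lambda>\<omega>. \<kappa> i (\<lambda>j\<in>pa G i. received G S x (Feature i) \<omega> $ j)) \<in> borel \<rightarrow>\<^sub>M prob_algebra borel"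
    by (rule measurable_compose[where g = "\<kappa> i"]) (use assms in \<open>simp add: markov_kernels_def\<close>)
next
  fix i and \<omega> \<omega>' :: "real^'n"
  assume "\<And>j. j \<in> pa G i \<Longrightarrow> \<omega> $ j = \<omega>' $ j"
  then show "\<kappa> i (\<lambda>j\<in>pa G i. received G S x (Feature i) \<omega> $ j) =
    \<kappa> i (\<lambda>j\<in>pa G i. received G S x (Feature i) \<omega>' $ j)"
    by (intro arg_cong[where f = "\<kappa> i"] restrict_ext) (auto simp: received_def)
qed

section \<open>Existence of topological orderings of the edges\<close>

lemma wf_causal_dag:
  assumes "causal_dag G"
  shows "wf ((\<lambda>i. (Feature (parent G i), child G i)) ` edges G)"
    and "wf (((\<lambda>i. (Feature (parent G i), child G i)) ` edges G)\<inverse>)"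
  \<comment> \<open>Finiteness turns acyclicity into well-foundedness both ways: the first serves to
    draw parents before children, the converse to number the edges.\<close>
  using assms
  by (auto simp: causal_dag_def edges_def intro!: finite_acyclic_wf finite_acyclic_wf_converse)

lemma wf_pa:
  assumes "causal_dag G"
  shows "wf {(j, i). j \<in> pa G i}"
  by (rule wf_subset[OF wf_inv_image[OF wf_causal_dag(1)[OF assms], of Feature]])
    (force simp: pa_def inv_image_def)

lemma ex_monotone_enumeration:
  assumes "finite A" "wf (r\<inverse>)"
  shows "\<exists>h. bij_betw h A {1..card A} \<and> (\<forall>a\<in>A. \<forall>b\<in>A. (a, b) \<in> r \<longrightarrow> h a < (h b :: nat))"
  using assms(1)
proof (induction "card A" arbitrary: A)
  case 0
  then show ?case by (auto simp: bij_betw_def)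
next
  case (Suc n)
  then have "A \<noteq> {}" by auto
  \<comment> \<open>An element without \<open>r\<close>-successor in \<open>A\<close> may safely
    receive the largest number, \<open>Suc n\<close>; the rest is numbered by induction.\<close>
  then obtain m where m: "m \<in> A" "\<And>b. b \<in> A \<Longrightarrow> (m, b) \<notin> r"
    by (metis wfE_min'[OF assms(2)] converse_iff)
  have n: "n = card (A - {m})"
    using Suc m by simp
  with Suc obtain h where h: "bij_betw h (A - {m}) {1..n}"
      "\<And>a b. a \<in> A - {m} \<Longrightarrow> b \<in> A - {m} \<Longrightarrow> (a, b) \<in> r \<Longrightarrow> h a < h b"
    by (metis finite_Diff)
  let ?h = "h(m := Suc n)"
  have "bij_betw ?h (A - {m}) {1..n}"
    using h(1) by (subst bij_betw_cong[of _ _ h]) auto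
  then have "bij_betw ?h ((A - {m}) \<union> {m}) ({1..n} \<union> {Suc n})"
    by (intro bij_betw_combine) (auto simp: bij_betw_def)
  moreover have "(A - {m}) \<union> {m} = A" "{1..n} \<union> {Suc n} = {1..card A}"
    using m Suc.hyps(2) by auto
  moreover have "?h a < ?h b" if "a \<in> A" "b \<in> A" "(a, b) \<in> r" for a b
  proof -
    have "a \<noteq> m"
      using m that by auto
    then have "h a \<in> {1..n}"
      using bij_betwE[OF h(1)] that by blast
    with \<open>a \<noteq> m\<close> show ?thesis
      using h(2)[of a b] that by auto
  qed
  ultimately show ?case
    by metis
qed

lemma edge_orderings_nonempty:
  assumes "causal_dag G"
  shows "edge_orderings G \<noteq> {}"
proof -
  let ?r = "{(j, k). j \<in> edges G \<and> k \<in> edges G \<and> child G j = Feature (parent G k)}"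
  have "wf (?r\<inverse>)"
    \<comment> \<open>Send each edge to its child: if \<open>k\<close> starts where \<open>j\<close>
      ends, then (\<open>child G j\<close>, \<open>child G k\<close>) is the arrow of edge
      \<open>k\<close> itself.\<close>
    by (rule wf_subset[OF wf_inv_image[OF wf_causal_dag(2)[OF assms], of "child G"]])
      (force simp: inv_image_def)
  then obtain h where h: "bij_betw h (edges G) {1..card (edges G)}"
      "\<And>j k. j \<in> edges G \<Longrightarrow> k \<in> edges G \<Longrightarrow> (j, k) \<in> ?r \<Longrightarrow> h j < h k"
    using ex_monotone_enumeration[of "edges G" ?r] by (auto simp: edges_def)
  let ?\<pi> = "\<lambda>i. if i \<in> edges G then h i else i"
  have "bij_betw ?\<pi> (edges G) (edges G)"
    using h(1) by (subst bij_betw_cong[of _ _ h]) (auto simp: edges_def)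
  then have "?\<pi> permutes edges G"
    by (intro bij_imp_permutes) auto
  with h(2) have "?\<pi> \<in> edge_orderings G"
    by (auto simp: edge_orderings_def)
  then show ?thesis by blast
qed

section \<open>Telescoping along an ordering and averaging over all orderings\<close>

lemma finite_edge_orderings: "finite (edge_orderings G)"
  by (rule finite_subset[OF _ finite_permutations[of "edges G"]])
    (auto simp: edge_orderings_def edges_def)

text \<open>Reindexing the edges by their position turns the sum into a telescoping one over
  consecutive prefixes of the ordering.\<close>

lemma sum_marginal_contributions:
  fixes v :: "nat set \<Rightarrow> 'a::ab_group_add"
  assumes "\<pi> permutes {1..m}"
  shows "(\<Sum>i\<in>{1..m}. v {j \<in> {1..m}. \<pi> j \<le> \<pi> i} - v {j \<in> {1..m}. \<pi> j < \<pi> i}) = v {1..m} - v {}"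
proof -
  define w where "w p = v {j \<in> {1..m}. \<pi> j \<le> p}" for p
  have \<pi>: "\<pi> j \<in> {1..m}" if "j \<in> {1..m}" for j
    using permutes_in_image[OF assms] that by blast
  \<comment> \<open>Positions start at 1, so the subtraction on naturals does not truncate.\<close>
  have "{j \<in> {1..m}. \<pi> j < \<pi> i} = {j \<in> {1..m}. \<pi> j \<le> \<pi> i - 1}" if "i \<in> {1..m}" for i
    using \<pi>[OF that] by auto
  then have "(\<Sum>i\<in>{1..m}. v {j \<in> {1..m}. \<pi> j \<le> \<pi> i} - v {j \<in> {1..m}. \<pi> j < \<pi> i})
      = (\<Sum>i\<in>{1..m}. w (\<pi> i) - w (\<pi> i - 1))"
    by (intro sum.cong refl) (simp add: w_def)
  also have "\<dots> = (\<Sum>p\<in>{1..m}. w p - w (p - 1))"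
    using sum.permute[OF assms, of "\<lambda>p. w p - w (p - 1)"] by (simp add: comp_def)
  also have "\<dots> = w m - w 0"
    using sum_telescope''[of 0 m w] by simp
  also have "{j \<in> {1..m}. \<pi> j \<le> m} = {1..m}" "{j \<in> {1..m}. \<pi> j \<le> 0} = {}"
    using \<pi> by force+
  then have "w m - w 0 = v {1..m} - v {}"
    by (simp only: w_def)
  finally show ?thesis .
qed

lemma sum_edge_attribution:
  assumes "causal_dag G"
  shows "(\<Sum>i\<in>edges G. edge_attribution G \<kappa> f x i) = U G \<kappa> f x (edges G) - U G \<kappa> f x {}"
proof -
  let ?D = "\<lambda>\<pi> i. U G \<kappa> f x {j \<in> edges G. \<pi> j \<le> \<pi> i} - U G \<kappa> f x {j \<in> edges G. \<pi> j < \<pi> i}"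
  \<comment> \<open>Since \<open>1 / 0 = 0\<close>, averaging a common value returns that value only
    when there is an ordering.\<close>
  have "card (edge_orderings G) \<noteq> 0"
    using edge_orderings_nonempty[OF assms] finite_edge_orderings[of G] by simp
  moreover have "(\<Sum>i\<in>edges G. ?D \<pi> i) = U G \<kappa> f x (edges G) - U G \<kappa> f x {}"
    if "\<pi> \<in> edge_orderings G" for \<pi>
    using that sum_marginal_contributions[of \<pi> "num_edges G" "U G \<kappa> f x"]
    by (auto simp: edge_orderings_def edges_def)
  ultimately show ?thesis
    unfolding edge_attribution_def sum_distrib_left[symmetric]
    by (subst sum.swap) simp
qed

lemma sum_feature_attribution:
  "(\<Sum>k\<in>UNIV. feature_attribution G \<kappa> f x k) = (\<Sum>i\<in>edges G. edge_attribution G \<kappa> f x i)"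
  unfolding feature_attribution_def
  by (rule sum.group) (auto simp: edges_def)

section \<open>Evaluating \<open>U\<close> at the empty and the full edge set\<close>

lemma eq_if_eq_on_dependencies:
  fixes f :: "real^'n::finite \<Rightarrow> real"
  assumes "\<And>j. depends_on f j \<Longrightarrow> u $ j = v $ j"
  shows "f u = f v"
proof -
  \<comment> \<open>\<open>depends_on\<close> compares only vectors differing in one coordinate, so
    \<open>u\<close> is changed into \<open>v\<close> one coordinate at a time; \<open>A\<close>
    holds the coordinates already replaced.\<close>
  have "f (\<chi> j. if j \<in> A then v $ j else u $ j) = f u" if "finite A" for A
    using that
  proof induction
    case (insert a A)
    have "f (\<chi> j. if j \<in> insert a A then v $ j else u $ j) = f (\<chi> j. if j \<in> A then v $ j else u $ j)"
    proof (cases "depends_on f a")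
      case True
      then have "(\<chi> j. if j \<in> insert a A then v $ j else u $ j) = (\<chi> j. if j \<in> A then v $ j else u $ j)"
        using assms by (auto simp: vec_eq_iff)
      then show ?thesis by simp
    next
      case False
      have "(\<chi> j. if j \<in> insert a A then v $ j else u $ j) $ i = (\<chi> j. if j \<in> A then v $ j else u $ j) $ i"
        if "i \<noteq> a" for i
        using that by simp
      with False show ?thesis unfolding depends_on_def by blast
    qed
    with insert.IH show ?case by simp
  qed simp
  from this[of UNIV] show ?thesis by simp
qed

lemma received_empty [simp]: "received G {} x v \<omega> = \<omega>"
  by (simp add: received_def)

text \<open>Existence and uniqueness justify unfolding \<open>THE\<close>.\<close>

lemma kernel_product_do_distribution:
  assumes "causal_dag G" "markov_kernels G \<kappa>"
  shows "kernel_product G (\<lambda>i \<omega>. \<kappa> i (\<lambda>j\<in>pa G i. received G S x (Feature i) \<omega> $ j)) UNIV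
    (do_distribution G \<kappa> x S)"
  unfolding do_distribution_def
  by (rule theI'[OF local_kernels.ex1_kernel_product[OF
        local_kernels_received[OF assms(2)] wf_pa[OF assms(1)]]])

text \<open>With no forced edge, both laws are generated by the same kernels, hence coincide by
  uniqueness.\<close>

lemma do_distribution_empty:
  assumes "causal_dag G" "markov_kernels G \<kappa>" "markov_distribution G \<kappa> P"
  shows "do_distribution G \<kappa> x {} = P"
  using local_kernels.kernel_product_unique[OF local_kernels_received[OF assms(2), of "{}" x]
      kernel_product_do_distribution[OF assms(1,2)]] assms(3)
  by (simp add: markov_distribution_def)

lemma U_edges:
  assumes "causal_dag G" "markov_kernels G \<kappa>" "model_edges G f"
  shows "U G \<kappa> f x (edges G) = f x"
proof -
  interpret prob_space "do_distribution G \<kappa> x (edges G)"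
    using local_kernels.kernel_product_prob_algebra[OF local_kernels_received[OF assms(2)]
      kernel_product_do_distribution[OF assms(1,2)]]
    by (simp add: space_prob_algebra)
  \<comment> \<open>By \<open>model_edges\<close>, each coordinate on which \<open>f\<close> depends
    has an edge to \<open>Target\<close>, and that edge transmits \<open>x\<close>. The integrand is
    thus constant, and the total mass is 1.\<close>
  have "f (received G (edges G) x Target \<omega>) = f x" for \<omega>
    by (rule eq_if_eq_on_dependencies[of f]) (use assms(3) in \<open>auto simp: received_def model_edges_def\<close>)
  then show ?thesis
    by (simp add: U_def prob_space)
qed

theorem mainTheorem1:
  fixes G :: "'n::finite causal_graph"
    and \<kappa> :: "'n \<Rightarrow> ('n \<Rightarrow> real) \<Rightarrow> real measure"
    and P :: "(real^'n) measure"
    and f :: "real^'n \<Rightarrow> real"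
    and x :: "real^'n"
  assumes "causal_dag G"
    and "model_edges G f"
    and "markov_kernels G \<kappa>"
    and "markov_distribution G \<kappa> P"
    and "integrable P f"
    and "\<And>S. S \<subseteq> edges G \<Longrightarrow>
           integrable (do_distribution G \<kappa> x S) (\<lambda>\<omega>. f (received G S x Target \<omega>))"
  shows "(\<Sum>k\<in>UNIV. feature_attribution G \<kappa> f x k) = f x - (\<integral>u. f u \<partial>P)"
  by (simp add: sum_feature_attribution sum_edge_attribution U_edges assms(1-3)
      U_def[of G \<kappa> f x "{}"] do_distribution_empty[OF assms(1,3,4)])

end
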